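(* Let $n\ge 1$, let $\mathbf{f}=\{f_0,\ldots,f_m\}\subset R=k[x_0,\ldots,x_n]$ be arbitrary forms of the same degree satisfying the canonical restrictions, and let $\widehat{\mathbf{f}}=\{\widehat{f_0},\ldots,\widehat{f_m}\}$ denote its Newton complementary dual set. Then: (a) For suitable indeterminates $y_0,\ldots,y_m$ over $k$, the identity map of $k[y_0,\ldots,y_m]$ induces (via the presentations $y_j\mapsto f_j$ and $y_j\mapsto \widehat{f_j}$) a $k$-algebra isomorphism $k[f_0,\ldots,f_m]\simeq k[\widehat{f_0},\ldots,\widehat{f_m}]$. (b) If $\mathbf{f}$ defines a birational map onto its image, then so does $\widehat{\mathbf{f}}$.
   Context: $k$ is an infinite field and $R=k[x_0,\ldots,x_n]$ is standard graded. Canonical restrictions: an ordered set $\mathbf{f}=\{f_0,\ldots,f_m\}\subset R$ of forms of the same degree $d\ge 1$, not all zero, satisfies the canonical restrictions if $\gcd\{f_0,\ldots,f_m\}=1$ and every variable $x_i$ appears effectively in some $f_j$. Newton complementary dual: write each $f_j=\sum_{\ell=1}^{r_j}c_{j,\ell}\,\mathbf{x}^{a_{j,\ell}}$ as the sum of its nonzero terms ($c_{j,\ell}\in k\setminus\{0\}$, distinct exponent vectors $a_{j,\ell}\in\mathbb{N}^{n+1}$ for fixed $j$). For $0\le i\le n$ let $\alpha_i$ be the maximum of the exponents of $x_i$ over all nonzero terms of all the forms $f_0,\ldots,f_m$, and put $\underline{\alpha}=(\alpha_0,\ldots,\alpha_n)$ (the directrix vector of $\mathbf{f}$). Then $\widehat{f_j}:=\sum_{\ell=1}^{r_j}c_{j,\ell}\,\mathbf{x}^{\underline{\alpha}-a_{j,\ell}}$,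 and $\widehat{\mathbf{f}}:=\{\widehat{f_0},\ldots,\widehat{f_m}\}$, a set of forms of degree $\alpha_0+\cdots+\alpha_n-d$. (The vector $\underline\alpha$ is computed from the whole set $\mathbf{f}$, not from each $f_j$ separately.) Birationality: a set $\mathbf{g}=\{g_0,\ldots,g_m\}$ of forms of the same degree $e$ in $R$ defines the rational map $(g_0:\cdots:g_m):\mathbb{P}^n\dashrightarrow\mathbb{P}^m$; it is birational onto its image if and only if $k(g_0,\ldots,g_m)=k(\mathbf{x}_e)$, where $\mathbf{x}_e$ denotes the set of all monomials of degree $e$ in $x_0,\ldots,x_n$. *)

theory Defs
  imports HOL.Hull "HOL-Library.Poly_Mapping" "HOL-Computational_Algebra.Fraction_Field"
begin

text \<open>
  Polynomials in the variables indexed by \<open>nat\<close> with coefficients in \<open>'k\<close>, as finitely supported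
  functions from exponent vectors to coefficients; multiplication on this type is convolution.
  The polynomial ring in \<open>x\<^sub>0, \<dots>, x\<^sub>n\<close> is the carrier \<open>poly_ring n\<close> inside this type.
\<close>

type_synonym 'k mpoly = "(nat \<Rightarrow>\<^sub>0 nat) \<Rightarrow>\<^sub>0 'k"

abbreviation monomial :: "(nat \<Rightarrow>\<^sub>0 nat) \<Rightarrow> 'k::field \<Rightarrow> 'k mpoly"
  where "monomial a c \<equiv> Poly_Mapping.single a c"

definition const :: "'k::field \<Rightarrow> 'k mpoly"
  where "const c = monomial 0 c"

definition exponents :: "nat \<Rightarrow> (nat \<Rightarrow>\<^sub>0 nat) set"
  where "exponents n = {a. Poly_Mapping.keys a \<subseteq> {..n}}"

definition poly_ring :: "nat \<Rightarrow> 'k::field mpoly set"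
  where "poly_ring n = {p. Poly_Mapping.keys p \<subseteq> exponents n}"

definition total_deg :: "nat \<Rightarrow> (nat \<Rightarrow>\<^sub>0 nat) \<Rightarrow> nat"
  where "total_deg n a = (\<Sum>i\<le>n. Poly_Mapping.lookup a i)"

text \<open>Forms of degree \<open>d\<close> in \<open>k[x\<^sub>0, \<dots>, x\<^sub>n]\<close>; the zero polynomial is a form of every degree.\<close>

definition forms :: "nat \<Rightarrow> nat \<Rightarrow> 'k::field mpoly set"
  where "forms n d = {p \<in> poly_ring n. \<forall>a\<in>Poly_Mapping.keys p. total_deg n a = d}"

text \<open>
  A family \<open>f\<^sub>0, \<dots>, f\<^sub>m\<close> is a function on \<open>nat\<close> of which only the values at \<open>j \<le> m\<close> matter.
  The third clause says that 1 is a greatest common divisor of the family. There \<open>dvd\<close> is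
  divisibility in the ambient polynomial ring; for elements of \<open>poly_ring n\<close> it agrees with
  divisibility in \<open>poly_ring n\<close>, since the variables in a factor of a nonzero polynomial
  occur in that polynomial.
\<close>

definition canonical_restrictions ::
    "nat \<Rightarrow> nat \<Rightarrow> nat \<Rightarrow> (nat \<Rightarrow> 'k::field mpoly) \<Rightarrow> bool"
  where "canonical_restrictions n m d f \<longleftrightarrow>
    1 \<le> d \<and> (\<forall>j\<le>m. f j \<in> forms n d) \<and> (\<exists>j\<le>m. f j \<noteq> 0) \<and>
    (\<forall>h\<in>poly_ring n. (\<forall>j\<le>m. h dvd f j) \<longrightarrow> h dvd 1) \<and>
    (\<forall>i\<le>n. \<exists>j\<le>m. \<exists>a\<in>Poly_Mapping.keys (f j). Poly_Mapping.lookup a i \<noteq> 0)"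

definition directrix :: "nat \<Rightarrow> nat \<Rightarrow> (nat \<Rightarrow> 'k::field mpoly) \<Rightarrow> (nat \<Rightarrow>\<^sub>0 nat)"
  where "directrix n m f =
    (\<Sum>i\<le>n. Poly_Mapping.single i
      (Max ((\<lambda>a. Poly_Mapping.lookup a i) ` (\<Union>j\<le>m. Poly_Mapping.keys (f j)))))"

text \<open>
  The subtraction of exponent vectors is truncated, but harmlessly so: for \<open>j \<le> m\<close> and
  \<open>f j \<in> poly_ring n\<close> the directrix dominates every exponent vector of \<open>f j\<close>.
\<close>

definition newton_dual ::
    "nat \<Rightarrow> nat \<Rightarrow> (nat \<Rightarrow> 'k::field mpoly) \<Rightarrow> nat \<Rightarrow> 'k mpoly"
  where "newton_dual n m f j =
    (\<Sum>a\<in>Poly_Mapping.keys (f j).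
       monomial (directrix n m f - a) (Poly_Mapping.lookup (f j) a))"

text \<open>The substitution homomorphism \<open>y\<^sub>j \<mapsto> g\<^sub>j\<close>.\<close>

definition subst :: "(nat \<Rightarrow> 'k::field mpoly) \<Rightarrow> 'k mpoly \<Rightarrow> 'k mpoly"
  where "subst g P =
    (\<Sum>a\<in>Poly_Mapping.keys P. const (Poly_Mapping.lookup P a) *
       (\<Prod>j\<in>Poly_Mapping.keys a. g j ^ Poly_Mapping.lookup a j))"

definition is_subalgebra :: "'k::field mpoly set \<Rightarrow> bool"
  where "is_subalgebra A \<longleftrightarrow>
    (\<forall>c. const c \<in> A) \<and> (\<forall>p\<in>A. \<forall>q\<in>A. p + q \<in> A) \<and> (\<forall>p\<in>A. \<forall>q\<in>A. p * q \<in> A)"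

definition generated_algebra :: "nat \<Rightarrow> (nat \<Rightarrow> 'k::field mpoly) \<Rightarrow> 'k mpoly set"
  where "generated_algebra m g = is_subalgebra hull (g ` {..m})"

definition is_algebra_iso ::
    "('k::field mpoly \<Rightarrow> 'k mpoly) \<Rightarrow> 'k mpoly set \<Rightarrow> 'k mpoly set \<Rightarrow> bool"
  where "is_algebra_iso \<psi> A B \<longleftrightarrow>
    bij_betw \<psi> A B \<and> (\<forall>c. \<psi> (const c) = const c) \<and>
    (\<forall>p\<in>A. \<forall>q\<in>A. \<psi> (p + q) = \<psi> p + \<psi> q) \<and> (\<forall>p\<in>A. \<forall>q\<in>A. \<psi> (p * q) = \<psi> p * \<psi> q)"

definition to_fract :: "'k::field mpoly \<Rightarrow> 'k mpoly fract"
  where "to_fract p = Fract p 1"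

definition is_subfield :: "'k::field mpoly fract set \<Rightarrow> bool"
  where "is_subfield K \<longleftrightarrow>
    (\<forall>c. to_fract (const c) \<in> K) \<and>
    (\<forall>u\<in>K. \<forall>v\<in>K. u + v \<in> K) \<and> (\<forall>u\<in>K. \<forall>v\<in>K. u * v \<in> K) \<and>
    (\<forall>u\<in>K. - u \<in> K) \<and> (\<forall>u\<in>K. inverse u \<in> K)"

text \<open>The field extension \<open>k(S)\<close> of \<open>k\<close> inside the field of rational functions.\<close>

definition generated_field :: "'k::field mpoly set \<Rightarrow> 'k mpoly fract set"
  where "generated_field S = is_subfield hull (to_fract ` S)"

definition monomials_of_degree :: "nat \<Rightarrow> nat \<Rightarrow> 'k::field mpoly set"
  where "monomials_of_degree n e = {monomial a 1 | a. a \<in> exponents n \<and> total_deg n a = e}"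

text \<open>
  The forms \<open>g\<^sub>0, \<dots>, g\<^sub>m\<close> of degree \<open>e\<close>, not all zero, define a rational map from \<open>n\<close>-dimensional
  to \<open>m\<close>-dimensional projective space, and it is birational onto its image when
  \<open>k(g\<^sub>0, \<dots>, g\<^sub>m) = k(x\<^sub>e)\<close>, where \<open>x\<^sub>e\<close> is the set of all monomials of degree \<open>e\<close>. Degree 0 is
  excluded: there the map is constant while both fields are \<open>k\<close>.
\<close>

definition birational_onto_image ::
    "nat \<Rightarrow> nat \<Rightarrow> nat \<Rightarrow> (nat \<Rightarrow> 'k::field mpoly) \<Rightarrow> bool"
  where "birational_onto_image n m e g \<longleftrightarrow>
    1 \<le> e \<and> (\<forall>j\<le>m. g j \<in> forms n e) \<and> (\<exists>j\<le>m. g j \<noteq> 0) \<and>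
    generated_field (g ` {..m}) = generated_field (monomials_of_degree n e)"

end

theory Submission
  imports Defs
begin

text \<open>
  Write \<open>\<alpha>\<close> for the directrix. Inverting the variables gives \<open>newton_dual n m f j = x\<^sup>\<alpha> f\<^sub>j(1/x)\<close>,
  where \<open>1/x\<close> stands for \<open>(1/x\<^sub>0, \<dots>, 1/x\<^sub>n)\<close>, and the inversion is an automorphism of the field of
  rational functions. Instead of passing to rational functions, the proof uses the relation
  \<open>reflects \<beta> p q\<close>, which says that \<open>q = x\<^sup>\<beta> p(1/x)\<close> for polynomials \<open>p\<close> and \<open>q\<close>. It is symmetric and
  multiplicative, with the vectors \<open>\<beta>\<close> being added. Hence for a form \<open>P\<close> of degree \<open>s\<close> in the \<open>y\<^sub>j\<close>
  the polynomial \<open>P(f)\<close> reflects to \<open>P\<close> evaluated at the dual family, with \<open>\<beta> = s\<alpha>\<close>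
  (\<open>reflects_subst\<close>); in particular one vanishes exactly if the other does.

  This needs \<open>P\<close> to be homogeneous, because the exponent \<open>s\<alpha>\<close> depends on its degree. But both
  families consist of forms of one positive degree, so substituting the components of \<open>P\<close> gives
  the components of the result, and every question about \<open>P\<close> splits into questions about its
  components (\<open>hom_component_subst\<close>). That the degree \<open>|\<alpha>| - d\<close> of the dual forms is positive
  is where the greatest common divisor enters: otherwise every nonzero \<open>f\<^sub>j\<close> would be a scalar
  multiple of \<open>x\<^sup>\<alpha>\<close> (\<open>degree_less_directrix\<close>).

  For (a), it follows that the two families satisfy the same polynomial relations, so both
  algebras are the same quotient of \<open>k[y\<^sub>0, \<dots>, y\<^sub>m]\<close>.

  For (b), birationality makes each ratio \<open>x\<^sup>a/x\<^sup>b\<close> of monomials of degree \<open>d\<close> a quotient \<open>P(f)/Q(f)\<close>.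
  In \<open>x\<^sup>a Q(f) = x\<^sup>b P(f)\<close> one may pass to a component with \<open>Q\<^sub>s(f) \<noteq> 0\<close> and reflect it; this writes
  \<open>x\<^sup>b/x\<^sup>a\<close> as a quotient of polynomials in the dual family (\<open>reflected_ratio_in_subfield\<close>). So the
  field generated by the dual family contains all \<open>x\<^sub>i/x\<^sub>0\<close>, hence all quotients of two forms of equal
  degree. Dividing one nonzero dual form by its quotient with a monomial of the same degree
  yields that monomial, and then all monomials of this degree.
\<close>

section \<open>Sums of monomials\<close>

lemma mpoly_induct_keys [consumes 1, case_names zero add]:
  assumes "Poly_Mapping.keys P \<subseteq> A"
    and "\<Phi> 0"
    and "\<And>a c p. a \<in> A \<Longrightarrow> \<Phi> p \<Longrightarrow> \<Phi> (monomial a c + p)"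
  shows "\<Phi> P"
proof -
  have P: "P = (\<Sum>a\<in>Poly_Mapping.keys P. monomial a (Poly_Mapping.lookup P a))"
    by (rule poly_mapping_eqI)
      (simp add: lookup_sum lookup_single when_def in_keys_iff)
  have "\<Phi> (\<Sum>a\<in>B. monomial a (Poly_Mapping.lookup P a))"
    if "finite B" "B \<subseteq> A" for B
    using that by (induction B rule: finite_induct) (auto intro: assms)
  with assms(1) P show ?thesis
    by (metis finite_keys)
qed

lemma mpoly_induct [case_names zero add]:
  assumes "\<Phi> 0" and "\<And>a c p. \<Phi> p \<Longrightarrow> \<Phi> (monomial a c + p)"
  shows "\<Phi> P"
  using subset_UNIV[of "Poly_Mapping.keys P"]
  by (induction P rule: mpoly_induct_keys) (simp_all add: assms)

lemma total_deg_add: "total_deg n (a + b) = total_deg n a + total_deg n b"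
  by (simp add: total_deg_def lookup_add sum.distrib)

lemma total_deg_zero: "total_deg n 0 = 0"
  by (simp add: total_deg_def)

lemma exponents_add_iff: "a + b \<in> exponents n \<longleftrightarrow> a \<in> exponents n \<and> b \<in> exponents n"
  by (auto simp: exponents_def in_keys_iff lookup_add subset_iff)

lemma zero_in_exponents: "0 \<in> exponents n"
  by (simp add: exponents_def)

lemma poly_ring_add: "p \<in> poly_ring n \<Longrightarrow> q \<in> poly_ring n \<Longrightarrow> p + q \<in> poly_ring n"
  using keys_add[of p q] by (auto simp: poly_ring_def)

lemma poly_ring_mult: "p \<in> poly_ring n \<Longrightarrow> q \<in> poly_ring n \<Longrightarrow> p * q \<in> poly_ring n"
  using keys_mult[of p q] by (fastforce simp: poly_ring_def exponents_add_iff)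

lemma poly_ring_monomial: "a \<in> exponents n \<Longrightarrow> monomial a c \<in> poly_ring n"
  by (auto simp: poly_ring_def)

lemma poly_ring_const: "const c \<in> poly_ring n"
  by (simp add: const_def poly_ring_monomial zero_in_exponents)

lemma const_1: "const 1 = 1"
  by (simp add: const_def)

lemma const_mult: "const (c * d) = const c * const d"
  by (simp add: const_def mult_single)

section \<open>Substitution\<close>

definition eval_monomial :: "(nat \<Rightarrow> 'k::field mpoly) \<Rightarrow> (nat \<Rightarrow>\<^sub>0 nat) \<Rightarrow> 'k mpoly"
  where "eval_monomial g a = (\<Prod>j\<in>Poly_Mapping.keys a. g j ^ Poly_Mapping.lookup a j)"

lemma eval_monomial_add:
  "eval_monomial g (a + b) = eval_monomial g a * eval_monomial g b"
proof -
  define S where "S = Poly_Mapping.keys a \<union> Poly_Mapping.keys b"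
  have *: "eval_monomial g c = (\<Prod>j\<in>S. g j ^ Poly_Mapping.lookup c j)"
    if "Poly_Mapping.keys c \<subseteq> S" for c
    unfolding eval_monomial_def
    by (rule prod.mono_neutral_left) (use that in \<open>auto simp: S_def in_keys_iff\<close>)
  have "Poly_Mapping.keys (a + b) \<subseteq> S"
    using keys_add[of a b] by (simp add: S_def)
  then show ?thesis
    by (simp add: * S_def lookup_add power_add prod.distrib)
qed

lemma subst_monomial: "subst g (monomial a c) = const c * eval_monomial g a"
  by (simp add: subst_def eval_monomial_def const_def)

lemma subst_zero: "subst g 0 = 0"
  by (simp add: subst_def)

lemma subst_add: "subst g (P + Q) = subst g P + subst g Q"
  unfolding subst_def
  by (rule setsum_keys_plus_distrib)
    (simp_all add: const_def single_add distrib_right)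

lemma subst_sum: "subst g (\<Sum>i\<in>I. P i) = (\<Sum>i\<in>I. subst g (P i))"
  by (induction I rule: infinite_finite_induct) (simp_all add: subst_zero subst_add)

lemma subst_const: "subst g (const c) = const c"
  by (simp add: const_def subst_monomial eval_monomial_def)

lemma subst_mult: "subst g (P * Q) = subst g P * subst g Q"
proof (induction P rule: mpoly_induct)
  case zero
  show ?case by (simp add: subst_zero)
next
  case (add a c P)
  have "subst g (monomial a c * Q) = subst g (monomial a c) * subst g Q"
  proof (induction Q rule: mpoly_induct)
    case zero
    show ?case by (simp add: subst_zero)
  next
    case (add b e Q)
    have "subst g (monomial a c * monomial b e) = subst g (monomial a c) * subst g (monomial b e)"
      by (simp add: mult_single subst_monomial eval_monomial_add const_mult mult_ac)
    with add.IH show ?case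
      by (simp add: distrib_left subst_add)
  qed
  with add.IH show ?case
    by (simp add: distrib_right subst_add)
qed

lemma subst_variable: "subst g (monomial (Poly_Mapping.single j 1) 1) = g j"
  by (simp add: subst_monomial eval_monomial_def const_1)

lemma poly_ring_variable: "j \<le> m \<Longrightarrow> monomial (Poly_Mapping.single j 1) c \<in> poly_ring m"
  by (rule poly_ring_monomial) (simp add: exponents_def)

lemma generator_in_subst_image: "j \<le> m \<Longrightarrow> g j \<in> subst g ` poly_ring m"
  by (rule rev_image_eqI[OF poly_ring_variable[of j m 1]]) (simp_all only: subst_variable)

lemma is_subalgebra_generated_algebra: "is_subalgebra (generated_algebra m g)"
  unfolding generated_algebra_def by (rule hull_in) (auto simp: is_subalgebra_def)

text \<open>
  The image of the substitution homomorphism is the smallest subalgebra containing the family, which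
  is what makes every element of it accessible through a polynomial in the \<open>y\<^sub>j\<close>.
\<close>

lemma generated_algebra_eq: "generated_algebra m g = subst g ` poly_ring m"
proof
  have "is_subalgebra (subst g ` poly_ring m)"
    unfolding is_subalgebra_def
    by (auto simp: image_iff subst_add[symmetric] subst_mult[symmetric]
        intro: poly_ring_add poly_ring_mult poly_ring_const subst_const[symmetric])
  moreover have "g ` {..m} \<subseteq> subst g ` poly_ring m"
    by (auto intro: generator_in_subst_image)
  ultimately show "generated_algebra m g \<subseteq> subst g ` poly_ring m"
    unfolding generated_algebra_def by (intro hull_minimal)
next
  let ?A = "generated_algebra m g"
  have A: "is_subalgebra ?A"
    by (rule is_subalgebra_generated_algebra)
  then have one: "1 \<in> ?A" and mult: "\<And>p q. p \<in> ?A \<Longrightarrow> q \<in> ?A \<Longrightarrow> p * q \<in> ?A"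
    by (auto simp: is_subalgebra_def const_1[symmetric])
  have gen: "g j \<in> ?A" if "j \<le> m" for j
    using that unfolding generated_algebra_def by (intro hull_inc) simp
  have pow: "g j ^ k \<in> ?A" if "j \<le> m" for j k
    using that by (induction k) (auto intro: one mult gen)
  have "(\<Prod>j\<in>S. g j ^ k j) \<in> ?A" if "finite S" "S \<subseteq> {..m}" for S k
    using that by (induction S rule: finite_induct) (auto intro: one mult pow)
  then have "eval_monomial g a \<in> ?A" if "a \<in> exponents m" for a
    using that by (simp add: eval_monomial_def exponents_def)
  then have mon: "subst g (monomial a c) \<in> ?A" if "a \<in> exponents m" for a c
    using A that by (simp add: subst_monomial is_subalgebra_def)
  have "subst g P \<in> ?A" if "P \<in> poly_ring m" for P
  proof -
    have "Poly_Mapping.keys P \<subseteq> exponents m"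
      using that by (simp add: poly_ring_def)
    then show ?thesis
    proof (induction P rule: mpoly_induct_keys)
      case zero
      show ?case
        using A by (metis const_def is_subalgebra_def single_zero subst_zero)
    next
      case (add a c p)
      then show ?case
        using A mon by (simp add: subst_add is_subalgebra_def)
    qed
  qed
  then show "subst g ` poly_ring m \<subseteq> ?A" by auto
qed

section \<open>Homogeneous components\<close>

definition hom_component :: "nat \<Rightarrow> nat \<Rightarrow> 'k::field mpoly \<Rightarrow> 'k mpoly"
  where "hom_component n s p =
    (\<Sum>a | a \<in> Poly_Mapping.keys p \<and> total_deg n a = s. monomial a (Poly_Mapping.lookup p a))"

lemma lookup_hom_component:
  "Poly_Mapping.lookup (hom_component n s p) a =
    (if total_deg n a = s then Poly_Mapping.lookup p a else 0)"
  by (auto simp: hom_component_def lookup_sum lookup_single when_def in_keys_iff)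

lemma hom_component_zero: "hom_component n s 0 = 0"
  by (rule poly_mapping_eqI) (simp add: lookup_hom_component)

lemma hom_component_add: "hom_component n s (p + q) = hom_component n s p + hom_component n s q"
  by (rule poly_mapping_eqI) (simp add: lookup_hom_component lookup_add)

lemma hom_component_monomial:
  "hom_component n s (monomial a c) = (if total_deg n a = s then monomial a c else 0)"
  by (rule poly_mapping_eqI) (auto simp: lookup_hom_component lookup_single when_def)

lemma hom_component_forms: "p \<in> poly_ring n \<Longrightarrow> hom_component n s p \<in> forms n s"
  by (auto simp: forms_def poly_ring_def in_keys_iff lookup_hom_component subset_iff
      split: if_splits)

lemma hom_component_of_form:
  "p \<in> forms n d \<Longrightarrow> hom_component n s p = (if s = d then p else 0)"
  by (rule poly_mapping_eqI) (auto simp: lookup_hom_component forms_def in_keys_iff)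

lemma sum_hom_components:
  "(\<Sum>s\<in>total_deg n ` Poly_Mapping.keys p. hom_component n s p) = p"
  by (rule poly_mapping_eqI) (auto simp: lookup_sum lookup_hom_component in_keys_iff image_iff)

lemma hom_component_monomial_mult:
  "hom_component n (total_deg n a + s) (monomial a c * p) = monomial a c * hom_component n s p"
  by (induction p rule: mpoly_induct)
    (auto simp: hom_component_zero distrib_left hom_component_add mult_single
      hom_component_monomial total_deg_add)

lemma forms_mult: "p \<in> forms n d \<Longrightarrow> q \<in> forms n e \<Longrightarrow> p * q \<in> forms n (d + e)"
  using keys_mult[of p q] by (fastforce simp: forms_def poly_ring_mult total_deg_add)

lemma forms_const: "const c \<in> forms n 0"
  by (auto simp: forms_def poly_ring_const) (auto simp: const_def total_deg_zero split: if_splits)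

lemma forms_one: "1 \<in> forms n 0"
  by (metis const_1 forms_const)

lemma forms_power: "p \<in> forms n d \<Longrightarrow> p ^ k \<in> forms n (d * k)"
  by (induction k) (auto simp: forms_one dest: forms_mult)

lemma sum_lookup_eq_total_deg:
  "a \<in> exponents m \<Longrightarrow> (\<Sum>j\<in>Poly_Mapping.keys a. Poly_Mapping.lookup a j) = total_deg m a"
  unfolding total_deg_def exponents_def
  by (rule sum.mono_neutral_left) (auto simp: in_keys_iff)

lemma forms_eval_monomial:
  assumes g: "\<forall>j\<le>m. g j \<in> forms n d" and a: "a \<in> exponents m"
  shows "eval_monomial g a \<in> forms n (d * total_deg m a)"
proof -
  have *: "(\<Prod>j\<in>S. g j ^ k j) \<in> forms n (d * (\<Sum>j\<in>S. k j))" if "finite S" "S \<subseteq> {..m}" for S k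
    using that
    by (induction S rule: finite_induct)
      (auto simp: forms_one distrib_left g intro!: forms_mult forms_power)
  show ?thesis
    using a *[of "Poly_Mapping.keys a" "Poly_Mapping.lookup a"] sum_lookup_eq_total_deg[OF a]
    by (simp add: eval_monomial_def exponents_def)
qed

text \<open>
  Since \<open>d\<close> is positive, monomials of different degrees in the \<open>y\<^sub>j\<close> are sent to forms of different
  degrees, so no cancellation between components can occur.
\<close>

lemma hom_component_subst:
  assumes g: "\<forall>j\<le>m. g j \<in> forms n d" and "1 \<le> d" and "P \<in> poly_ring m"
  shows "hom_component n (d * s) (subst g P) = subst g (hom_component m s P)"
proof -
  have "Poly_Mapping.keys P \<subseteq> exponents m"
    using assms(3) by (simp add: poly_ring_def)
  then show ?thesis
  proof (induction P rule: mpoly_induct_keys)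
    case zero
    show ?case by (simp add: subst_zero hom_component_zero)
  next
    case (add a c P)
    have "subst g (monomial a c) \<in> forms n (d * total_deg m a)"
      using forms_mult[OF forms_const forms_eval_monomial[OF g add.hyps]]
      by (simp add: subst_monomial)
    then show ?case
      using \<open>1 \<le> d\<close> add.IH
      by (auto simp: subst_add hom_component_add hom_component_monomial subst_zero
          hom_component_of_form)
  qed
qed

lemma subst_eq_0_iff_components:
  assumes "\<forall>j\<le>m. g j \<in> forms n d" and "1 \<le> d" and "P \<in> poly_ring m"
  shows "subst g P = 0 \<longleftrightarrow> (\<forall>s. subst g (hom_component m s P) = 0)"
proof
  assume "subst g P = 0"
  then show "\<forall>s. subst g (hom_component m s P) = 0"
    by (simp add: hom_component_subst[OF assms, symmetric] hom_component_zero)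
next
  assume "\<forall>s. subst g (hom_component m s P) = 0"
  then have "subst g (\<Sum>s\<in>total_deg m ` Poly_Mapping.keys P. hom_component m s P) = 0"
    by (simp add: subst_sum)
  then show "subst g P = 0"
    by (simp add: sum_hom_components)
qed

section \<open>Reflection of exponent vectors\<close>

text \<open>
  This is the graph of \<open>p \<mapsto> x\<^sup>\<beta> p(1/x)\<close>, restricted to those \<open>p\<close> for which the result is a polynomial.
  Pairing exponents by \<open>a + b = \<beta>\<close> avoids truncated subtraction and makes the symmetry visible.
\<close>

inductive reflects :: "(nat \<Rightarrow>\<^sub>0 nat) \<Rightarrow> 'k::field mpoly \<Rightarrow> 'k mpoly \<Rightarrow> bool" for \<beta>
  where
    zero: "reflects \<beta> 0 0"
  | add_monomial: "reflects \<beta> p q \<Longrightarrow> a + b = \<beta> \<Longrightarrow>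
      reflects \<beta> (monomial a c + p) (monomial b c + q)"

lemma reflects_sym: "reflects \<beta> p q \<Longrightarrow> reflects \<beta> q p"
proof (induction rule: reflects.induct)
  case (add_monomial p q a b c)
  then show ?case
    by (intro reflects.add_monomial) (simp_all add: add.commute)
qed (rule reflects.zero)

lemma reflects_monomial: "a + b = \<beta> \<Longrightarrow> reflects \<beta> (monomial a c) (monomial b c)"
  using reflects.add_monomial[OF reflects.zero] by fastforce

lemma reflects_const: "reflects 0 (const c) (const c)"
  unfolding const_def by (rule reflects_monomial) simp

lemma reflects_add: "reflects \<beta> p q \<Longrightarrow> reflects \<beta> p' q' \<Longrightarrow> reflects \<beta> (p + p') (q + q')"
  by (induction rule: reflects.induct) (auto intro: reflects.intros simp: add.assoc)

lemma reflects_sum: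
  "(\<And>i. i \<in> I \<Longrightarrow> reflects \<beta> (p i) (q i)) \<Longrightarrow> reflects \<beta> (\<Sum>i\<in>I. p i) (\<Sum>i\<in>I. q i)"
  by (induction I rule: infinite_finite_induct) (auto intro: reflects.zero reflects_add)

lemma reflects_monomial_mult:
  assumes "reflects \<gamma> p q" and "a + b = \<beta>"
  shows "reflects (\<beta> + \<gamma>) (monomial a c * p) (monomial b c * q)"
  using assms(1)
proof (induction rule: reflects.induct)
  case zero
  show ?case by (simp add: reflects.zero)
next
  case (add_monomial p q a' b' c')
  moreover have "(a + a') + (b + b') = \<beta> + \<gamma>"
    using add_monomial.hyps assms(2) by (auto simp: algebra_simps)
  ultimately show ?case
    by (simp add: distrib_left mult_single reflects.add_monomial)
qed

lemma reflects_mult: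
  assumes "reflects \<beta> p q" and "reflects \<gamma> p' q'"
  shows "reflects (\<beta> + \<gamma>) (p * p') (q * q')"
  using assms(1)
  by (induction rule: reflects.induct)
    (auto simp: distrib_right intro: reflects.zero reflects_add reflects_monomial_mult[OF assms(2)])

lemma reflects_lookup:
  "reflects \<beta> p q \<Longrightarrow> a + b = \<beta> \<Longrightarrow> Poly_Mapping.lookup p a = Poly_Mapping.lookup q b"
proof (induction rule: reflects.induct)
  case (add_monomial p q a' b' c)
  then have "a' = a \<longleftrightarrow> b' = b"
    by (metis add_left_imp_eq add_right_imp_eq)
  with add_monomial show ?case
    by (simp add: lookup_add lookup_single when_def)
qed simp

lemma reflects_keys:
    assumes *: "reflects \<beta> p q" "a \<in> Poly_Mapping.keys p"
  shows "\<exists>b\<in>Poly_Mapping.keys q. a + b = \<beta>"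
proof -
  from * have "\<exists>b. a + b = \<beta>"
  proof (induction rule: reflects.induct)
    case (add_monomial p q a' b' c)
    then show ?case
      using keys_add[of "monomial a' c" p] by (auto split: if_splits)
  qed simp
  then show ?thesis
    using * reflects_lookup by (metis in_keys_iff)
qed

lemma reflects_eq_0_iff: "reflects \<beta> p q \<Longrightarrow> p = 0 \<longleftrightarrow> q = 0"
  by (metis equals0D keys_eq_empty keys_zero poly_mapping_eqI reflects_keys reflects_sym
      all_not_in_conv)

text \<open>
  The values at exponent vectors below \<open>\<beta>\<close> are prescribed by \<open>reflects_lookup\<close>, and by
  \<open>reflects_keys\<close> there are no other exponent vectors.
\<close>

lemma reflects_unique:
  assumes "reflects \<beta> p q" and "reflects \<beta> p q'"
  shows "q = q'"
proof (rule poly_mapping_eqI)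
  fix b
  show "Poly_Mapping.lookup q b = Poly_Mapping.lookup q' b"
  proof (cases "\<exists>a. a + b = \<beta>")
    case True
    then show ?thesis
      using reflects_lookup assms by metis
  next
    case False
    then have "b \<notin> Poly_Mapping.keys q" "b \<notin> Poly_Mapping.keys q'"
      using reflects_keys[OF reflects_sym[OF assms(1)]]
        reflects_keys[OF reflects_sym[OF assms(2)]] by (metis add.commute)+
    then show ?thesis by (simp add: in_keys_iff)
  qed
qed

lemma reflects_forms:
  assumes "reflects \<beta> p q" and p: "p \<in> forms n d" and \<beta>: "\<beta> \<in> exponents n"
  shows "q \<in> forms n (total_deg n \<beta> - d)"
proof -
  have "b \<in> exponents n \<and> total_deg n b = total_deg n \<beta> - d" if b: "b \<in> Poly_Mapping.keys q" for b
  proof -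
    obtain a where a: "a \<in> Poly_Mapping.keys p" "b + a = \<beta>"
      using reflects_keys[OF reflects_sym[OF assms(1)] b] by (metis add.commute)
    then show ?thesis
      using p \<beta> exponents_add_iff[of b a n] total_deg_add[of n b a] by (auto simp: forms_def)
  qed
  then show ?thesis
    by (auto simp: forms_def poly_ring_def)
qed

lemma reflects_power: "reflects \<alpha> p q \<Longrightarrow> reflects (of_nat k * \<alpha>) (p ^ k) (q ^ k)"
proof (induction k)
  case 0
  show ?case using reflects_const[of 1] by (simp add: const_1)
next
  case (Suc k)
  then show ?case
    using reflects_mult[of \<alpha> p q "of_nat k * \<alpha>" "p ^ k" "q ^ k"] by (simp add: distrib_right)
qed

lemma reflects_eval_monomial:
  assumes fg: "\<forall>j\<le>m. reflects \<alpha> (f j) (g j)" and a: "a \<in> exponents m"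
  shows "reflects (of_nat (total_deg m a) * \<alpha>) (eval_monomial f a) (eval_monomial g a)"
proof -
  have *: "reflects (of_nat (\<Sum>j\<in>S. k j) * \<alpha>) (\<Prod>j\<in>S. f j ^ k j) (\<Prod>j\<in>S. g j ^ k j)"
    if "finite S" "S \<subseteq> {..m}" for S k
    using that
  proof (induction S rule: finite_induct)
    case empty
    show ?case using reflects_const[of 1] by (simp add: const_1)
  next
    case (insert j S)
    then show ?case
      using fg by (simp add: distrib_right reflects_mult reflects_power del: of_nat_sum)
  qed
  show ?thesis
    using a *[of "Poly_Mapping.keys a" "Poly_Mapping.lookup a"] sum_lookup_eq_total_deg[OF a]
    by (simp add: eval_monomial_def exponents_def)
qed

text \<open>
  Homogeneity of \<open>P\<close> is essential: a monomial of degree \<open>t\<close> in the \<open>y\<^sub>j\<close> reflects with respect to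
  \<open>t\<alpha>\<close>, and only polynomials reflected with respect to the same vector can be added.
\<close>

lemma reflects_subst:
  assumes fg: "\<forall>j\<le>m. reflects \<alpha> (f j) (g j)" and P: "P \<in> forms m s"
  shows "reflects (of_nat s * \<alpha>) (subst f P) (subst g P)"
proof -
  have "Poly_Mapping.keys P \<subseteq> {a \<in> exponents m. total_deg m a = s}"
    using P by (auto simp: forms_def poly_ring_def)
  then show ?thesis
  proof (induction P rule: mpoly_induct_keys)
    case zero
    show ?case by (simp add: subst_zero reflects.zero)
  next
    case (add a c P)
    then have "reflects (0 + of_nat s * \<alpha>) (subst f (monomial a c)) (subst g (monomial a c))"
      unfolding subst_monomial
      using reflects_mult[OF reflects_const reflects_eval_monomial[OF fg, of a]] by auto
    with add.IH show ?case
      by (simp add: subst_add reflects_add)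
  qed
qed

text \<open>
  A relation holds exactly if all its homogeneous components do, and for these
  \<open>reflects_subst\<close> transfers vanishing from one family to the other.
\<close>

lemma subst_eq_0_iff_reflected:
  assumes "\<forall>j\<le>m. reflects \<alpha> (f j) (g j)"
    and "\<forall>j\<le>m. f j \<in> forms n d" and "1 \<le> d"
    and "\<forall>j\<le>m. g j \<in> forms n e" and "1 \<le> e"
    and "P \<in> poly_ring m"
  shows "subst f P = 0 \<longleftrightarrow> subst g P = 0"
  using subst_eq_0_iff_components[OF assms(2,3,6)] subst_eq_0_iff_components[OF assms(4,5,6)]
    reflects_eq_0_iff[OF reflects_subst[OF assms(1) hom_component_forms[OF assms(6)]]]
  by blast

section \<open>Subalgebras with the same relations\<close>

lemma algebra_iso_if_same_relations:
  assumes "\<And>P. P \<in> poly_ring m \<Longrightarrow> subst f P = 0 \<longleftrightarrow> subst g P = 0"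
  shows "\<exists>\<psi>. is_algebra_iso \<psi> (generated_algebra m f) (generated_algebra m g) \<and>
    (\<forall>P\<in>poly_ring m. \<psi> (subst f P) = subst g P)"
proof -
  have eq_iff: "subst f P = subst f Q \<longleftrightarrow> subst g P = subst g Q"
    if "P \<in> poly_ring m" "Q \<in> poly_ring m" for P Q
  proof -
    have "subst h P = subst h Q \<longleftrightarrow> subst h (P + const (-1) * Q) = 0" for h :: "nat \<Rightarrow> 'a mpoly"
      by (simp add: subst_add subst_mult subst_const) (simp add: const_def single_uminus)
    then show ?thesis
      using assms that by (metis poly_ring_add poly_ring_const poly_ring_mult)
  qed
  \<comment> \<open>By \<open>eq_iff\<close> the value does not depend on the polynomial chosen to represent \<open>x\<close>.\<close>
  define \<psi> where "\<psi> x = subst g (SOME P. P \<in> poly_ring m \<and> subst f P = x)" for x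
  have \<psi>: "\<psi> (subst f P) = subst g P" if "P \<in> poly_ring m" for P
    unfolding \<psi>_def by (rule someI2[of _ P]) (use that eq_iff in auto)
  have "bij_betw \<psi> (generated_algebra m f) (generated_algebra m g)"
    unfolding generated_algebra_eq bij_betw_def inj_on_def
    using eq_iff \<psi> by (auto simp: image_image)
  moreover have "\<psi> (const c) = const c" for c
    using \<psi>[OF poly_ring_const[of c]] by (simp add: subst_const)
  ultimately have "is_algebra_iso \<psi> (generated_algebra m f) (generated_algebra m g)"
    unfolding is_algebra_iso_def generated_algebra_eq
    by (auto simp: \<psi> poly_ring_add poly_ring_mult simp flip: subst_add subst_mult)
  with \<psi> show ?thesis by blast
qed

section \<open>Subfields of the field of rational functions\<close>

lemma to_fract_add: "to_fract (p + q) = to_fract p + to_fract q"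
  and to_fract_mult: "to_fract (p * q) = to_fract p * to_fract q"
  and to_fract_eq_iff: "to_fract p = to_fract q \<longleftrightarrow> p = q"
  and to_fract_0: "to_fract 0 = 0"
  and to_fract_1: "to_fract 1 = 1"
  by (simp_all add: to_fract_def eq_fract Zero_fract_def One_fract_def)

lemma to_fract_eq_0_iff: "to_fract p = 0 \<longleftrightarrow> p = 0"
  using to_fract_eq_iff[of p 0] by (simp add: to_fract_0)

lemma monomial_neq_0: "monomial a (1::'k::field) \<noteq> 0"
  by (metis lookup_single_eq lookup_zero zero_neq_one)

lemma
  assumes "is_subfield K"
  shows subfield_const: "to_fract (const c) \<in> K"
    and subfield_add: "u \<in> K \<Longrightarrow> v \<in> K \<Longrightarrow> u + v \<in> K"
    and subfield_mult: "u \<in> K \<Longrightarrow> v \<in> K \<Longrightarrow> u * v \<in> K"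
    and subfield_divide: "u \<in> K \<Longrightarrow> v \<in> K \<Longrightarrow> u / v \<in> K"
  using assms by (auto simp: is_subfield_def divide_inverse)

lemma subfield_0: "is_subfield K \<Longrightarrow> 0 \<in> K"
  using subfield_const[of K 0] by (simp add: const_def to_fract_0)

lemma subfield_1: "is_subfield K \<Longrightarrow> 1 \<in> K"
  using subfield_const[of K 1] by (simp add: const_1 to_fract_1)

lemma is_subfield_generated_field: "is_subfield (generated_field S)"
  unfolding generated_field_def by (rule hull_in) (auto simp: is_subfield_def)

lemma to_fract_in_generated_field: "p \<in> S \<Longrightarrow> to_fract p \<in> generated_field S"
  unfolding generated_field_def by (intro hull_inc) simp

lemma generated_field_minimal:
  "is_subfield K \<Longrightarrow> (\<And>p. p \<in> S \<Longrightarrow> to_fract p \<in> K) \<Longrightarrow> generated_field S \<subseteq> K"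
  unfolding generated_field_def by (intro hull_minimal) auto

text \<open>
  The quotients of elements of the generated algebra already form a subfield, so nested
  inverses never have to be dealt with.
\<close>

lemma generated_field_cases:
  fixes g :: "nat \<Rightarrow> 'k::field mpoly"
  assumes "u \<in> generated_field (g ` {..m})"
  obtains P Q where "P \<in> poly_ring m" "Q \<in> poly_ring m" "subst g Q \<noteq> 0"
    "u = to_fract (subst g P) / to_fract (subst g Q)"
proof -
  define A where "A = subst g ` poly_ring m"
  define K where "K = {to_fract p / to_fract q | p q. p \<in> A \<and> q \<in> A \<and> q \<noteq> 0}"
  have K: "to_fract p / to_fract q \<in> K" if "p \<in> A" "q \<in> A" "q \<noteq> 0" for p q
    using that by (auto simp: K_def)
  have "is_subalgebra A"
    unfolding A_def generated_algebra_eq[symmetric] by (rule is_subalgebra_generated_algebra)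
  then have A_const: "const c \<in> A" and A_add: "p \<in> A \<Longrightarrow> q \<in> A \<Longrightarrow> p + q \<in> A"
    and A_mult: "p \<in> A \<Longrightarrow> q \<in> A \<Longrightarrow> p * q \<in> A" for c p q
    by (simp_all add: is_subalgebra_def)
  have int: "to_fract p \<in> K" if "p \<in> A" for p
    using K[OF that A_const[of 1]] by (simp add: const_1 to_fract_1)
  have cases: "\<exists>p\<in>A. \<exists>q\<in>A.
      q \<noteq> 0 \<and> u = to_fract p / to_fract q" if "u \<in> K" for u
    using that by (auto simp: K_def)
  have "is_subfield K"
    unfolding is_subfield_def
  proof (intro conjI allI ballI)
    show "to_fract (const c) \<in> K" for c
      by (intro int A_const)
  next
    fix u v assume "u \<in> K" "v \<in> K"
    then obtain p q p' q' where *: "p \<in> A" "q \<in> A"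
      "p' \<in> A" "q' \<in> A" "q \<noteq> 0" "q' \<noteq> 0"
      "u = to_fract p / to_fract q" "v = to_fract p' / to_fract q'"
      using cases by meson
    have "u + v = to_fract (p * q' + p' * q) / to_fract (q * q')"
      using * by (simp add: to_fract_add to_fract_mult to_fract_eq_0_iff add_frac_eq)
    then show "u + v \<in> K"
      using K[of "p * q' + p' * q" "q * q'"] * by (simp add: A_const A_add A_mult)
    have "u * v = to_fract (p * p') / to_fract (q * q')"
      using * by (simp add: to_fract_mult)
    then show "u * v \<in> K"
      using K[of "p * p'" "q * q'"] * by (simp add: A_const A_add A_mult)
  next
    fix u assume "u \<in> K"
    then obtain p q where *: "p \<in> A" "q \<in> A"
      "q \<noteq> 0" "u = to_fract p / to_fract q"
      using cases by meson
    have "- u = to_fract (const (-1) * p) / to_fract q"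
      using * by (simp add: const_def single_uminus to_fract_def)
    then show "- u \<in> K"
      using K[of "const (-1) * p" q] * by (simp add: A_const A_add A_mult)
    show "inverse u \<in> K"
    proof (cases "p = 0")
      case True
      then show ?thesis
        using int[OF *(1)] * by (simp add: to_fract_0)
    next
      case False
      then show ?thesis using K[OF *(2,1)] * by simp
    qed
  qed
  moreover have "to_fract p \<in> K" if "p \<in> g ` {..m}" for p
    using that int generator_in_subst_image[of _ m g] by (auto simp: A_def)
  ultimately have "u \<in> K"
    using generated_field_minimal assms by blast
  then show ?thesis
    using that by (auto simp: K_def A_def)
qed

lemma subfield_form_over_monomial:
  assumes K: "is_subfield K"
    and ratio: "\<And>b. b \<in> exponents n \<Longrightarrow> total_deg n b = e \<Longrightarrow>
      to_fract (monomial b 1) / to_fract (monomial a 1) \<in> K"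
    and p: "p \<in> forms n e"
  shows "to_fract p / to_fract (monomial a 1) \<in> K"
proof -
  have "Poly_Mapping.keys p \<subseteq> {b \<in> exponents n. total_deg n b = e}"
    using p by (auto simp: forms_def poly_ring_def)
  then show ?thesis
  proof (induction p rule: mpoly_induct_keys)
    case zero
    show ?case using K by (simp add: to_fract_0 subfield_0)
  next
    case (add b c p)
    have "monomial b c = const c * monomial b 1"
      by (simp add: const_def mult_single)
    then have "to_fract (monomial b c) / to_fract (monomial a 1) =
        to_fract (const c) * (to_fract (monomial b 1) / to_fract (monomial a 1))"
      by (simp add: to_fract_mult)
    then have "to_fract (monomial b c) / to_fract (monomial a 1) \<in> K"
      using ratio[of b] add.hyps K by (simp only: subfield_const subfield_mult mem_Collect_eq)
    with add.IH show ?case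
      using K by (simp add: to_fract_add add_divide_distrib subfield_add)
  qed
qed

text \<open>
  Dehomogenization: \<open>x\<^sup>b\<close> divided by the power of \<open>x\<^sub>0\<close> of the same degree is the product of the
  \<open>(x\<^sub>i/x\<^sub>0)\<close> with exponents \<open>b\<^sub>i\<close>.
\<close>

lemma subfield_ratio_of_variable_ratios:
  assumes K: "is_subfield K"
    and var: "\<And>i. i \<le> n \<Longrightarrow> to_fract (monomial (Poly_Mapping.single i 1) 1) /
      to_fract (monomial (Poly_Mapping.single 0 1) 1) \<in> K"
  shows "b \<in> exponents n \<Longrightarrow>
    to_fract (monomial b 1) / to_fract (monomial (Poly_Mapping.single 0 (total_deg n b)) 1) \<in> K"
proof (induction "total_deg n b" arbitrary: b)
  case 0
  then have "b = 0"
    by (intro poly_mapping_eqI) (auto simp: total_deg_def exponents_def in_keys_iff subset_iff)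
  then show ?case
    using subfield_1[OF K] by (simp add: total_deg_zero to_fract_1)
next
  case (Suc t)
  then obtain i where i: "i \<le> n" "Poly_Mapping.lookup b i \<noteq> 0"
    unfolding total_deg_def by (metis atMost_iff nat.distinct(1) sum.neutral)
  define b' where "b' = b - Poly_Mapping.single i 1"
  have b: "b = Poly_Mapping.single i 1 + b'"
    by (rule poly_mapping_eqI) (use i in \<open>auto simp: b'_def lookup_add lookup_minus lookup_single when_def\<close>)
  have "total_deg n (Poly_Mapping.single i 1) = 1"
    using i(1) by (simp add: total_deg_def lookup_single when_def)
  then have t: "total_deg n b = 1 + total_deg n b'" "t = total_deg n b'"
    using Suc.hyps(2) b total_deg_add[of n "Poly_Mapping.single i 1" b'] by simp_all
  have b': "b' \<in> exponents n"
    using Suc.prems b exponents_add_iff by metis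
  have X_add: "to_fract (monomial (a + c) 1) = to_fract (monomial a 1) * to_fract (monomial c 1)"
    for a c by (simp add: mult_single flip: to_fract_mult)
  have eq: "to_fract (monomial b 1) / to_fract (monomial (Poly_Mapping.single 0 (total_deg n b)) 1) =
      (to_fract (monomial (Poly_Mapping.single i 1) 1) / to_fract (monomial (Poly_Mapping.single 0 1) 1)) *
      (to_fract (monomial b' 1) / to_fract (monomial (Poly_Mapping.single 0 (total_deg n b')) 1))"
    unfolding t(1) by (simp only: b[THEN arg_cong[of _ _ "\<lambda>b. monomial b 1"]] single_add X_add times_divide_times_eq)
  show ?case
    unfolding eq by (rule subfield_mult[OF K var[OF i(1)] Suc.hyps(1)[OF t(2) b']])
qed

section \<open>Reflection of rational expressions\<close>

text \<open>
  Inverting all variables maps \<open>x\<^sup>a/x\<^sup>b\<close> to \<open>x\<^sup>b/x\<^sup>a\<close>. On the level of polynomials, clear denominators in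
  \<open>x\<^sup>a/x\<^sup>b = P(f)/Q(f)\<close>, pass to homogeneous components, and reflect both sides of the resulting
  equation. The equality of degrees of \<open>a\<close> and \<open>b\<close> ensures that taking a component selects the
  same degree \<open>s\<close> in \<open>P\<close> and in \<open>Q\<close>, so both sides reflect with respect to the same vector.
\<close>

lemma reflected_ratio_in_subfield:
  fixes f g :: "nat \<Rightarrow> 'k::field mpoly"
  assumes fg: "\<forall>j\<le>m. reflects \<alpha> (f j) (g j)"
    and f: "\<forall>j\<le>m. f j \<in> forms n d" and d: "1 \<le> d"
    and deg: "total_deg n a = total_deg n b"
    and mem: "to_fract (monomial a 1) / to_fract (monomial b 1) \<in> generated_field (f ` {..m})"
  shows "to_fract (monomial b 1) / to_fract (monomial a 1) \<in> generated_field (g ` {..m})"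
proof -
  let ?L = "generated_field (g ` {..m})"
  obtain P Q where PQ: "P \<in> poly_ring m" "Q \<in> poly_ring m" "subst f Q \<noteq> 0"
    and eq: "to_fract (monomial a 1) / to_fract (monomial b 1) =
      to_fract (subst f P) / to_fract (subst f Q)"
    using generated_field_cases[OF mem] .
  from eq have "to_fract (monomial a 1 * subst f Q) = to_fract (monomial b 1 * subst f P)"
    using PQ(3) by (simp add: to_fract_mult to_fract_eq_0_iff monomial_neq_0 frac_eq_eq mult.commute)
  then have rel: "monomial a 1 * subst f Q = monomial b 1 * subst f P"
    by (simp add: to_fract_eq_iff)
  obtain s where s: "subst f (hom_component m s Q) \<noteq> 0"
    using subst_eq_0_iff_components[OF f d PQ(2)] PQ(3) by blast
  define P' Q' where "P' = hom_component m s P" and "Q' = hom_component m s Q"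
  have forms: "P' \<in> forms m s" "Q' \<in> forms m s"
    using PQ by (simp_all add: P'_def Q'_def hom_component_forms)
  have rel': "monomial a 1 * subst f Q' = monomial b 1 * subst f P'"
    unfolding P'_def Q'_def
    using arg_cong[OF rel, of "hom_component n (total_deg n a + d * s)"]
      hom_component_monomial_mult[of n a "d * s" 1 "subst f Q"]
      hom_component_monomial_mult[of n b "d * s" 1 "subst f P"]
      hom_component_subst[OF f d PQ(1)] hom_component_subst[OF f d PQ(2)] deg
    by simp
  have "reflects ((a + b) + of_nat s * \<alpha>) (monomial a 1 * subst f Q') (monomial b 1 * subst g Q')"
    by (intro reflects_monomial_mult reflects_subst[OF fg] forms refl)
  moreover have "reflects ((a + b) + of_nat s * \<alpha>) (monomial b 1 * subst f P') (monomial a 1 * subst g P')"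
    by (intro reflects_monomial_mult reflects_subst[OF fg] forms add.commute)
  ultimately have rel_g: "monomial b 1 * subst g Q' = monomial a 1 * subst g P'"
    using rel' reflects_unique by metis
  have nz: "subst g Q' \<noteq> 0"
    using reflects_eq_0_iff[OF reflects_subst[OF fg forms(2)]] s by (simp add: Q'_def)
  have "to_fract (monomial b 1) * to_fract (subst g Q') = to_fract (monomial a 1) * to_fract (subst g P')"
    using rel_g by (metis to_fract_mult)
  then have "to_fract (monomial b 1) / to_fract (monomial a 1) =
      to_fract (subst g P') / to_fract (subst g Q')"
    using nz by (simp add: to_fract_eq_0_iff monomial_neq_0 frac_eq_eq mult.commute)
  moreover have "to_fract (subst g R) \<in> ?L" if "R \<in> poly_ring m" for R
  proof -
    have "is_subalgebra {p. to_fract p \<in> ?L}"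
      using is_subfield_generated_field[of "g ` {..m}"]
      by (auto simp: is_subalgebra_def is_subfield_def to_fract_add to_fract_mult)
    then have "generated_algebra m g \<subseteq> {p. to_fract p \<in> ?L}"
      unfolding generated_algebra_def
      by (intro hull_minimal) (auto intro: to_fract_in_generated_field)
    with that show ?thesis by (auto simp: generated_algebra_eq)
  qed
  ultimately show ?thesis
    using forms by (simp add: forms_def subfield_divide is_subfield_generated_field)
qed

lemma birational_reflected:
  fixes f g :: "nat \<Rightarrow> 'k::field mpoly"
  assumes fg: "\<forall>j\<le>m. reflects \<alpha> (f j) (g j)"
    and g: "\<forall>j\<le>m. g j \<in> forms n e" and e: "1 \<le> e"
    and bir: "birational_onto_image n m d f"
  shows "birational_onto_image n m e g"
proof -
  let ?L = "generated_field (g ` {..m})"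
  let ?X = "\<lambda>a. to_fract (monomial a (1::'k))"
  have L: "is_subfield ?L" by (rule is_subfield_generated_field)
  have d: "1 \<le> d" and f: "\<forall>j\<le>m. f j \<in> forms n d"
    and field: "generated_field (f ` {..m}) = generated_field (monomials_of_degree n d)"
    using bir by (auto simp: birational_onto_image_def)
  obtain l where l: "l \<le> m" "f l \<noteq> 0"
    using bir by (auto simp: birational_onto_image_def)
  then have gl: "g l \<noteq> 0"
    using fg reflects_eq_0_iff by blast
  have ratio_d: "?X b / ?X a \<in> ?L"
    if "a \<in> exponents n" "b \<in> exponents n" "total_deg n a = d" "total_deg n b = d" for a b
  proof (rule reflected_ratio_in_subfield[OF fg f d])
    show "?X a / ?X b \<in> generated_field (f ` {..m})"
      unfolding field
      by (intro subfield_divide is_subfield_generated_field to_fract_in_generated_field)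
        (use that in \<open>auto simp: monomials_of_degree_def\<close>)
  qed (use that in simp_all)
  have var: "?X (Poly_Mapping.single i 1) / ?X (Poly_Mapping.single 0 1) \<in> ?L" if "i \<le> n" for i
  proof -
    \<comment> \<open>Ratios of degree \<open>d\<close> are available, so \<open>x\<^sub>i/x\<^sub>0\<close> is expanded by \<open>x\<^sub>0\<^sup>d\<^sup>-\<^sup>1\<close>.\<close>
    define c :: "nat \<Rightarrow>\<^sub>0 nat" where "c = Poly_Mapping.single 0 (d - 1)"
    have "?X (Poly_Mapping.single i 1 + c) / ?X (Poly_Mapping.single 0 1 + c) \<in> ?L"
      by (rule ratio_d)
        (use that d in \<open>auto simp: c_def exponents_add_iff total_deg_add\<close>,
         auto simp: exponents_def total_deg_def lookup_single when_def)
    moreover have "?X (a + c) = ?X a * ?X c" for a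
      by (simp flip: to_fract_mult add: mult_single)
    ultimately show ?thesis
      by (simp add: to_fract_eq_0_iff monomial_neq_0)
  qed
  let ?Z = "?X (Poly_Mapping.single 0 e)"
  have ratio_e: "?X b / ?Z \<in> ?L" if "b \<in> exponents n" "total_deg n b = e" for b
    using subfield_ratio_of_variable_ratios[OF L var that(1)] that(2) by simp
  have "to_fract (g l) \<in> ?L"
    using l(1) by (intro to_fract_in_generated_field) simp
  moreover have "to_fract (g l) / ?Z \<in> ?L"
    using g l(1) by (blast intro: subfield_form_over_monomial[OF L ratio_e])
  \<comment> \<open>The ratios only give quotients of degree 0; dividing the nonzero form \<open>g l\<close> of degree \<open>e\<close> by
    its own quotient with \<open>x\<^sub>0\<^sup>e\<close> recovers \<open>x\<^sub>0\<^sup>e\<close> itself.\<close>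
  ultimately have "to_fract (g l) / (to_fract (g l) / ?Z) \<in> ?L"
    by (rule subfield_divide[OF L])
  then have Z: "?Z \<in> ?L"
    using gl by (simp add: to_fract_eq_0_iff)
  have X: "?X b \<in> ?L" if "b \<in> exponents n" "total_deg n b = e" for b
    using subfield_mult[OF L ratio_e[OF that] Z] by (simp add: to_fract_eq_0_iff monomial_neq_0)
  have "generated_field (monomials_of_degree n e) \<subseteq> ?L"
    by (rule generated_field_minimal[OF L]) (auto simp: monomials_of_degree_def X)
  moreover have "?L \<subseteq> generated_field (monomials_of_degree n e)" (is "_ \<subseteq> ?M")
  proof (rule generated_field_minimal[OF is_subfield_generated_field])
    fix p assume "p \<in> g ` {..m}"
    then have p: "p \<in> forms n e" using g by auto
    have "?X b / ?X 0 \<in> ?M" if "b \<in> exponents n" "total_deg n b = e" for b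
    proof -
      have "?X b \<in> ?M"
        using that by (intro to_fract_in_generated_field) (auto simp: monomials_of_degree_def)
      then show ?thesis by (simp add: to_fract_1)
    qed
    from subfield_form_over_monomial[OF is_subfield_generated_field this p]
    show "to_fract p \<in> ?M" by (simp add: to_fract_1)
  qed
  ultimately show ?thesis
    using e g l(1) gl by (auto simp: birational_onto_image_def)
qed

section \<open>The Newton complementary dual\<close>

lemma directrix_in_exponents: "directrix n m f \<in> exponents n"
  by (auto simp: exponents_def directrix_def in_keys_iff lookup_sum lookup_single when_def
      split: if_splits)

text \<open>
  For \<open>i > n\<close> both sides are 0, so the bound holds for every variable index, and
  subtraction from the directrix is never truncated.
\<close>

lemma lookup_le_directrix:
  assumes "j \<le> m" "f j \<in> poly_ring n" "a \<in> Poly_Mapping.keys (f j)"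
  shows "Poly_Mapping.lookup a i \<le> Poly_Mapping.lookup (directrix n m f) i"
proof (cases "i \<le> n")
  case True
  then have "Poly_Mapping.lookup (directrix n m f) i =
      Max ((\<lambda>a. Poly_Mapping.lookup a i) ` (\<Union>j\<le>m. Poly_Mapping.keys (f j)))"
    by (simp add: directrix_def lookup_sum lookup_single when_def)
  also have "\<dots> \<ge> Poly_Mapping.lookup a i"
    using assms by (intro Max_ge) auto
  finally show ?thesis .
next
  case False
  then have "Poly_Mapping.lookup a i = 0"
    using assms by (auto simp: poly_ring_def exponents_def in_keys_iff subset_iff)
  then show ?thesis by simp
qed

lemma directrix_split:
  assumes "j \<le> m" "f j \<in> poly_ring n" "a \<in> Poly_Mapping.keys (f j)"
  shows "a + (directrix n m f - a) = directrix n m f"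
  by (rule poly_mapping_eqI) (simp add: lookup_add lookup_minus lookup_le_directrix[where f = f, OF assms])

lemma reflects_newton_dual:
  assumes "j \<le> m" "f j \<in> poly_ring n"
  shows "reflects (directrix n m f) (f j) (newton_dual n m f j)"
proof -
  have "reflects (directrix n m f)
      (\<Sum>a\<in>Poly_Mapping.keys (f j). monomial a (Poly_Mapping.lookup (f j) a)) (newton_dual n m f j)"
    unfolding newton_dual_def
    by (intro reflects_sum reflects_monomial directrix_split[of j]) (use assms in auto)
  moreover have "(\<Sum>a\<in>Poly_Mapping.keys (f j). monomial a (Poly_Mapping.lookup (f j) a)) = f j"
    by (rule poly_mapping_eqI) (simp add: lookup_sum lookup_single when_def in_keys_iff)
  ultimately show ?thesis by simp
qed

text \<open>
  Every exponent vector \<open>a\<close> of the family has degree \<open>d\<close> and is bounded by the directrix. If the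
  directrix had degree at most \<open>d\<close>, it would equal every such \<open>a\<close>, and the monomial with
  this exponent vector, of positive degree \<open>d\<close>, would be a common divisor.
\<close>

lemma degree_less_directrix:
  fixes f :: "nat \<Rightarrow> 'k::field mpoly"
  assumes "canonical_restrictions n m d f"
  shows "d < total_deg n (directrix n m f)"
proof (rule ccontr)
  let ?\<alpha> = "directrix n m f"
  assume "\<not> d < total_deg n ?\<alpha>"
  note canon = assms[unfolded canonical_restrictions_def]
  have ring: "f j \<in> poly_ring n" if "j \<le> m" for j
    using canon that by (auto simp: forms_def)
  have key: "a = ?\<alpha> \<and> total_deg n ?\<alpha> = d" if "j \<le> m" "a \<in> Poly_Mapping.keys (f j)" for j a
  proof -
    have \<alpha>: "a + (?\<alpha> - a) = ?\<alpha>"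
      using directrix_split[where f = f, OF that(1) ring[OF that(1)] that(2)] .
    have "total_deg n a = d"
      using canon that by (auto simp: forms_def)
    with \<alpha> \<open>\<not> d < _\<close> have "total_deg n (?\<alpha> - a) = 0" "total_deg n ?\<alpha> = d"
      using total_deg_add[of n a "?\<alpha> - a"] by simp_all
    moreover have "?\<alpha> - a \<in> exponents n"
      using \<alpha> directrix_in_exponents exponents_add_iff by metis
    ultimately have "?\<alpha> - a = 0"
      by (intro poly_mapping_eqI) (auto simp: total_deg_def exponents_def in_keys_iff subset_iff)
    with \<alpha> \<open>total_deg n ?\<alpha> = d\<close> show ?thesis by simp
  qed
  have "monomial ?\<alpha> 1 dvd f j" if "j \<le> m" for j
  proof -
    have "f j = monomial ?\<alpha> (Poly_Mapping.lookup (f j) ?\<alpha>)"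
      using key[OF that] by (intro poly_mapping_eqI) (auto simp: lookup_single when_def in_keys_iff)
    also have "\<dots> = monomial ?\<alpha> 1 * const (Poly_Mapping.lookup (f j) ?\<alpha>)"
      by (simp add: const_def mult_single)
    finally show ?thesis by (metis dvd_triv_left)
  qed
  then have "monomial ?\<alpha> (1::'k) dvd 1"
    using canon poly_ring_monomial[OF directrix_in_exponents] by blast
  then obtain q where q: "1 = monomial ?\<alpha> (1::'k) * q" by (auto elim: dvdE)
  have "(0 :: nat \<Rightarrow>\<^sub>0 nat) \<in> Poly_Mapping.keys (1 :: 'k mpoly)" by simp
  then obtain b where "?\<alpha> + b = 0"
    using keys_mult[of "monomial ?\<alpha> 1" q] unfolding q[symmetric] by auto
  then have "total_deg n ?\<alpha> = 0"
    using total_deg_add[of n ?\<alpha> b] by (simp add: total_deg_zero)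
  moreover obtain j a where "j \<le> m" "a \<in> Poly_Mapping.keys (f j)"
    using canon by (metis in_keys_iff lookup_zero poly_mapping_eqI)
  ultimately show False
    using key canon by fastforce
qed

theorem theorem1p9:
  fixes n m d :: nat and f :: "nat \<Rightarrow> 'k::field mpoly"
  assumes "infinite (UNIV :: 'k set)"
    and "1 \<le> n"
    and "canonical_restrictions n m d f"
  shows "(\<exists>\<psi>. is_algebra_iso \<psi> (generated_algebra m f) (generated_algebra m (newton_dual n m f)) \<and>
            (\<forall>P\<in>poly_ring m. \<psi> (subst f P) = subst (newton_dual n m f) P)) \<and>
         (birational_onto_image n m d f \<longrightarrow>
            birational_onto_image n m (total_deg n (directrix n m f) - d) (newton_dual n m f))"
proof -
  let ?\<alpha> = "directrix n m f" and ?g = "newton_dual n m f"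
  let ?e = "total_deg n ?\<alpha> - d"
  have d: "1 \<le> d" and f: "\<forall>j\<le>m. f j \<in> forms n d"
    using assms(3) by (auto simp: canonical_restrictions_def)
  have fg: "\<forall>j\<le>m. reflects ?\<alpha> (f j) (?g j)"
    using f by (auto simp: forms_def intro: reflects_newton_dual)
  have g: "\<forall>j\<le>m. ?g j \<in> forms n ?e"
    using fg f directrix_in_exponents reflects_forms by blast
  have e: "1 \<le> ?e"
    using degree_less_directrix[OF assms(3)] by simp
  show ?thesis
    using algebra_iso_if_same_relations[OF subst_eq_0_iff_reflected[OF fg f d g e]]
      birational_reflected[OF fg g e] by blast
qed

end
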